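(* For every integer $k\ge 1$, the set $\mathrm{RedVHC}_k(\mathrm{Av}_{3k}(312))$ of reduced valid hook configurations with exactly $k$ hooks on $312$-avoiding permutations of length $3k$ is in bijection with the set $\mathrm{Dyck}^3_k$ of 3D-Dyck words of length $3k$.
   Context: $S_n$ is the set of permutations $\pi=\pi_1\cdots\pi_n$ of $\{1,\dots,n\}$. $\pi$ is $312$-avoiding if there are no indices $a<b<c$ with $\pi_b<\pi_c<\pi_a$; $\mathrm{Av}_n(312)\subseteq S_n$ is the set of $312$-avoiding permutations of length $n$. The plot of $\pi$ is the set of points $(i,\pi_i)$, $1\le i\le n$. If $\pi_i>\pi_{i+1}$, then $i$ is a descent, $(i,\pi_i)$ is a descent top and $(i+1,\pi_{i+1})$ is a descent bottom. A hook on $\pi$ from $(i,\pi_i)$ to $(j,\pi_j)$, where $i<j$ and $\pi_i<\pi_j$, consists of the vertical segment from $(i,\pi_i)$ up to $(i,\pi_j)$ followed by the horizontal segment from $(i,\pi_j)$ to $(j,\pi_j)$. The point $(i,\pi_i)$ is its southwest (SW) endpoint and $(j,\pi_j)$ its northeast (NE) endpoint. A valid hook configuration on $\pi$ is a set of hooks on $\pi$ such that: (i) the set of SW endpoints of the hooks is exactly the set of descent tops of $\pi$; (ii) no point of the plot lies directly above a hook (for a hook from $(i,\pi_i)$ to $(j,\pi_j)$ there is no $l$ with $i<l<j$ and $\pi_l>\pi_j$); (iii) distinct hooks do not intersect, except at endpoints (the NE endpoint of one hook may be the SW endpoint of another; two hooks sharing the same NE endpoint, or the same SW endpoint, overlap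 in a segment and are not allowed). It is reduced if every point of the plot is a hook endpoint or a descent bottom (or both). For a set $S$ of permutations, $\mathrm{RedVHC}_k(S)$ is the set of all reduced valid hook configurations with exactly $k$ hooks on permutations in $S$ (a configuration includes the data of its underlying permutation). A 3D-Dyck word of length $3k$ is a word with $k$ letters X, $k$ letters Y and $k$ letters Z such that in every prefix the number of X's is at least the number of Y's, which is at least the number of Z's. $\mathrm{Dyck}^3_k$ is the set of these words. *)

theory Defs
  imports "HOL-Analysis.Analysis" "HOL-Combinatorics.Permutations" "HOL-Library.Sublist"
begin

text \<open>
  A permutation of length \<open>n\<close> is a function \<open>\<pi>\<close> with \<open>\<pi> permutes {1..n}\<close>, so that \<open>\<pi>\<close> is the
  identity outside \<open>{1..n}\<close>. As \<open>\<pi>\<close> does not determine \<open>n\<close>, the length is passed explicitly.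
\<close>

definition perms :: "nat \<Rightarrow> (nat \<Rightarrow> nat) set" where
  "perms n = {\<pi>. \<pi> permutes {1..n}}"

definition avoids_312 :: "nat \<Rightarrow> (nat \<Rightarrow> nat) \<Rightarrow> bool" where
  "avoids_312 n \<pi> \<longleftrightarrow>
     \<not> (\<exists>a\<in>{1..n}. \<exists>b\<in>{1..n}. \<exists>c\<in>{1..n}. a < b \<and> b < c \<and> \<pi> b < \<pi> c \<and> \<pi> c < \<pi> a)"

definition Av312 :: "nat \<Rightarrow> (nat \<Rightarrow> nat) set" where
  "Av312 n = {\<pi> \<in> perms n. avoids_312 n \<pi>}"

definition plot :: "nat \<Rightarrow> (nat \<Rightarrow> nat) \<Rightarrow> (nat \<times> nat) set" where
  "plot n \<pi> = {(i, \<pi> i) | i. i \<in> {1..n}}"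

definition descents :: "nat \<Rightarrow> (nat \<Rightarrow> nat) \<Rightarrow> nat set" where
  "descents n \<pi> = {i. 1 \<le> i \<and> i < n \<and> \<pi> i > \<pi> (i + 1)}"

definition descent_tops :: "nat \<Rightarrow> (nat \<Rightarrow> nat) \<Rightarrow> (nat \<times> nat) set" where
  "descent_tops n \<pi> = {(i, \<pi> i) | i. i \<in> descents n \<pi>}"

definition descent_bottoms :: "nat \<Rightarrow> (nat \<Rightarrow> nat) \<Rightarrow> (nat \<times> nat) set" where
  "descent_bottoms n \<pi> = {(i + 1, \<pi> (i + 1)) | i. i \<in> descents n \<pi>}"

text \<open>
  A hook from \<open>(i, \<pi> i)\<close> to \<open>(j, \<pi> j)\<close> is encoded by the pair of indices \<open>(i, j)\<close>; the
  function \<open>hook_path\<close> gives the corresponding subset of the plane.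
\<close>

definition hooks_on :: "nat \<Rightarrow> (nat \<Rightarrow> nat) \<Rightarrow> (nat \<times> nat) set" where
  "hooks_on n \<pi> = {(i, j). i \<in> {1..n} \<and> j \<in> {1..n} \<and> i < j \<and> \<pi> i < \<pi> j}"

definition SW :: "(nat \<Rightarrow> nat) \<Rightarrow> nat \<times> nat \<Rightarrow> nat \<times> nat" where
  "SW \<pi> h = (fst h, \<pi> (fst h))"

definition NE :: "(nat \<Rightarrow> nat) \<Rightarrow> nat \<times> nat \<Rightarrow> nat \<times> nat" where
  "NE \<pi> h = (snd h, \<pi> (snd h))"

definition real_point :: "nat \<times> nat \<Rightarrow> real \<times> real" where
  "real_point p = (real (fst p), real (snd p))"

definition hook_path :: "(nat \<Rightarrow> nat) \<Rightarrow> nat \<times> nat \<Rightarrow> (real \<times> real) set" where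
  "hook_path \<pi> h = (case h of (i, j) \<Rightarrow>
     closed_segment (real_point (i, \<pi> i)) (real_point (i, \<pi> j)) \<union>
     closed_segment (real_point (i, \<pi> j)) (real_point (j, \<pi> j)))"

text \<open>
  In the last condition, a common point of two distinct hooks has to be an endpoint of both.
  For hooks with a common SW endpoint (or a common NE endpoint) this fails,
  because they overlap in a nondegenerate segment.
\<close>

definition valid_hook_configuration ::
    "nat \<Rightarrow> (nat \<Rightarrow> nat) \<Rightarrow> (nat \<times> nat) set \<Rightarrow> bool" where
  "valid_hook_configuration n \<pi> H \<longleftrightarrow>
     H \<subseteq> hooks_on n \<pi> \<and>
     SW \<pi> ` H = descent_tops n \<pi> \<and>
     (\<forall>(i, j)\<in>H. \<not> (\<exists>l. i < l \<and> l < j \<and> \<pi> l > \<pi> j)) \<and>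
     (\<forall>h\<in>H. \<forall>h'\<in>H. h \<noteq> h' \<longrightarrow>
        hook_path \<pi> h \<inter> hook_path \<pi> h' \<subseteq>
          real_point ` ({SW \<pi> h, NE \<pi> h} \<inter> {SW \<pi> h', NE \<pi> h'}))"

definition reduced :: "nat \<Rightarrow> (nat \<Rightarrow> nat) \<Rightarrow> (nat \<times> nat) set \<Rightarrow> bool" where
  "reduced n \<pi> H \<longleftrightarrow> plot n \<pi> \<subseteq> SW \<pi> ` H \<union> NE \<pi> ` H \<union> descent_bottoms n \<pi>"

definition RedVHC ::
    "nat \<Rightarrow> nat \<Rightarrow> (nat \<Rightarrow> nat) set \<Rightarrow> ((nat \<Rightarrow> nat) \<times> (nat \<times> nat) set) set" where
  "RedVHC n k S =
     {(\<pi>, H). \<pi> \<in> S \<and> valid_hook_configuration n \<pi> H \<and> reduced n \<pi> H \<and> card H = k}"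

datatype letter = X | Y | Z

definition Dyck3 :: "nat \<Rightarrow> letter list set" where
  "Dyck3 k = {w. length w = 3 * k \<and>
     count_list w X = k \<and> count_list w Y = k \<and> count_list w Z = k \<and>
     (\<forall>u. prefix u w \<longrightarrow> count_list u X \<ge> count_list u Y \<and> count_list u Y \<ge> count_list u Z)}"

end

theory Submission
  imports Defs
begin

text \<open>
  By counting, every point of such a configuration is exactly one of descent bottom, descent
  top and northeast endpoint. Reading the points by increasing height and writing \<open>X\<close>, \<open>Y\<close>,
  \<open>Z\<close> for these kinds gives a 3D-Dyck word, because a descent bottom lies below its top and a
  southwest endpoint below its northeast endpoint.

  Avoiding 312 forces the points of kind \<open>Y\<close> and \<open>Z\<close> to increase from left to right and the
  matching of descent bottoms with descent tops to be noncrossing in height; disjointness of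
  the hooks says that the matching of \<open>Y\<close> with \<open>Z\<close> is noncrossing too. Since a ballot
  sequence has exactly one noncrossing matching, the word determines the configuration, and
  every word yields one.
\<close>

section \<open>Noncrossing matchings\<close>

text \<open>This is a parenthesis matching: \<open>U\<close> holds the opening points and
  \<open>V\<close> the closing ones. Bijectivity of both projections says that every point is
  matched exactly once.\<close>

definition noncrossing_matching :: "nat set \<Rightarrow> nat set \<Rightarrow> (nat \<times> nat) set \<Rightarrow> bool" where
  "noncrossing_matching U V M \<longleftrightarrow>
     bij_betw fst M U \<and> bij_betw snd M V \<and> (\<forall>(u, v)\<in>M. u < v) \<and>
     (\<forall>(u, v)\<in>M. \<forall>(u', v')\<in>M. \<not> (u < u' \<and> u' < v \<and> v < v'))"

lemma noncrossing_matchingI: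
  assumes "bij_betw fst M U" "bij_betw snd M V"
    and "\<And>u v. (u, v) \<in> M \<Longrightarrow> u < v"
    and "\<And>u v u' v'. (u, v) \<in> M \<Longrightarrow> (u', v') \<in> M \<Longrightarrow> u < u' \<Longrightarrow> u' < v \<Longrightarrow> v < v' \<Longrightarrow> False"
  shows "noncrossing_matching U V M"
  using assms unfolding noncrossing_matching_def by blast

context
  fixes U V M
  assumes M: "noncrossing_matching U V M"
begin

lemma matching_less: "(u, v) \<in> M \<Longrightarrow> u < v"
  using M unfolding noncrossing_matching_def by blast

lemma matching_noncrossing:
  "(u, v) \<in> M \<Longrightarrow> (u', v') \<in> M \<Longrightarrow> u < u' \<Longrightarrow> u' < v \<Longrightarrow> v < v' \<Longrightarrow> False"
  using M unfolding noncrossing_matching_def by blast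

lemma matching_fst: "fst ` M = U"
  using M by (simp add: noncrossing_matching_def bij_betw_def)

lemma matching_snd: "snd ` M = V"
  using M by (simp add: noncrossing_matching_def bij_betw_def)

lemma matching_mem: "(u, v) \<in> M \<Longrightarrow> u \<in> U \<and> v \<in> V"
  using matching_fst matching_snd by force

lemma matching_ex_snd: "u \<in> U \<Longrightarrow> \<exists>v. (u, v) \<in> M"
  using matching_fst by force

lemma matching_ex_fst: "v \<in> V \<Longrightarrow> \<exists>u. (u, v) \<in> M"
  using matching_snd by force

lemma matching_inj_fst: "inj_on fst M"
  using M by (simp add: noncrossing_matching_def bij_betw_def)

lemma matching_inj_snd: "inj_on snd M"
  using M by (simp add: noncrossing_matching_def bij_betw_def)

lemma matching_unique_snd: "(u, v) \<in> M \<Longrightarrow> (u, v') \<in> M \<Longrightarrow> v = v'"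
  using inj_onD[OF matching_inj_fst, of "(u, v)" "(u, v')"] by simp

lemma matching_unique_fst: "(u, v) \<in> M \<Longrightarrow> (u', v) \<in> M \<Longrightarrow> u = u'"
  using inj_onD[OF matching_inj_snd, of "(u, v)" "(u', v)"] by simp

text \<open>Sending each closing point up to \<open>t\<close> to its partner is injective, and the
  partner is smaller, hence also at most \<open>t\<close>.\<close>

lemma matching_ballot:
  assumes "finite U"
  shows "card (V \<inter> {..t}) \<le> card (U \<inter> {..t})"
proof -
  define K where "K = {(u, v) \<in> M. v \<le> t}"
  have "V \<inter> {..t} = snd ` K"
    using matching_snd unfolding K_def by force
  moreover have "fst ` K \<subseteq> U \<inter> {..t}"
    using matching_less matching_mem unfolding K_def by fastforce
  moreover have "inj_on fst K" "inj_on snd K"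
    using inj_on_subset[OF matching_inj_fst, of K] inj_on_subset[OF matching_inj_snd, of K]
    by (auto simp: K_def)
  ultimately show ?thesis
    using assms by (metis card_image card_mono finite_Int)
qed

text \<open>If another opening point were matched with the first closing point, its pair
  would be crossed by the pair of the opening point closest to that closing point.\<close>

lemma matching_first_closing:
  assumes "finite U" "finite V" "V \<noteq> {}"
  shows "(Max (U \<inter> {..<Min V}), Min V) \<in> M"
proof -
  let ?v = "Min V" and ?u = "Max (U \<inter> {..<Min V})"
  obtain u where u: "(u, ?v) \<in> M"
    using matching_ex_fst assms Min_in by blast
  have "u \<in> U \<inter> {..<?v}"
    using u matching_less matching_mem by blast
  then have mem: "?u \<in> U \<inter> {..<?v}" and le: "u \<le> ?u"
    using assms by (metis Max_in empty_iff finite_Int, simp)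
  then obtain v where v: "(?u, v) \<in> M"
    using matching_ex_snd by blast
  have "v = ?v"
  proof (rule ccontr)
    assume "v \<noteq> ?v"
    then have "?v < v"
      using matching_mem[OF v] assms by (simp add: order_less_le)
    moreover have "u \<noteq> ?u"
      using matching_unique_snd u v \<open>v \<noteq> ?v\<close> by metis
    ultimately show False
      using matching_noncrossing[OF u v] le mem by simp
  qed
  then show ?thesis
    using v by simp
qed

lemma matching_remove:
  assumes "(u, v) \<in> M"
  shows "noncrossing_matching (U - {u}) (V - {v}) (M - {(u, v)})"
proof (rule noncrossing_matchingI)
  have "fst ` (M - {(u, v)}) = U - {u}"
    using inj_on_image_set_diff[OF matching_inj_fst, of M "{(u, v)}"] assms matching_fst by simp
  then show "bij_betw fst (M - {(u, v)}) (U - {u})"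
    using matching_inj_fst by (simp add: bij_betw_def inj_on_diff)
  have "snd ` (M - {(u, v)}) = V - {v}"
    using inj_on_image_set_diff[OF matching_inj_snd, of M "{(u, v)}"] assms matching_snd by simp
  then show "bij_betw snd (M - {(u, v)}) (V - {v})"
    using matching_inj_snd by (simp add: bij_betw_def inj_on_diff)
qed (auto dest: matching_less matching_noncrossing)

end

section \<open>Uniqueness and existence of noncrossing matchings\<close>

text \<open>The pair of the first closing point is forced by \<open>matching_first_closing\<close>.
  Removing it leaves matchings of the same smaller sets, so induction on the number of closing
  points applies.\<close>

lemma noncrossing_matching_unique:
  assumes "finite V" "finite U" "noncrossing_matching U V M" "noncrossing_matching U V M'"
  shows "M = M'"
  using assms
proof (induction "card V" arbitrary: U V M M')
  case 0
  then have "V = {}" by simp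
  then show ?case
    using matching_snd[OF 0(4)] matching_snd[OF 0(5)] by simp
next
  case (Suc n)
  let ?v = "Min V" and ?u = "Max (U \<inter> {..<Min V})"
  have ne: "V \<noteq> {}" using Suc.hyps(2) by auto
  have mem: "(?u, ?v) \<in> M" "(?u, ?v) \<in> M'"
    using matching_first_closing Suc.prems ne by blast+
  have "n = card (V - {?v})"
    using Suc.hyps(2) Suc.prems(1) ne by simp
  then have "M - {(?u, ?v)} = M' - {(?u, ?v)}"
    using Suc.hyps(1) Suc.prems(1,2) matching_remove[OF Suc.prems(3) mem(1)]
      matching_remove[OF Suc.prems(4) mem(2)] by blast
  then show ?case
    using mem by blast
qed

text \<open>The greedy rule works: match the first closing point with the nearest opening point
  before it, remove both and recurse.\<close>

lemma noncrossing_matching_exists: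
  assumes "finite V" "finite U" "U \<inter> V = {}" "card U = card V"
    and "\<And>t. card (V \<inter> {..t}) \<le> card (U \<inter> {..t})"
  shows "\<exists>M. noncrossing_matching U V M"
  using assms
proof (induction "card V" arbitrary: U V)
  case 0
  then have "noncrossing_matching U V {}"
    by (simp add: noncrossing_matching_def bij_betw_def)
  then show ?case by blast
next
  case (Suc n)
  define v where "v = Min V"
  define u where "u = Max (U \<inter> {..<v})"
  have ne: "V \<noteq> {}" using Suc.hyps(2) by auto
  have vV: "v \<in> V" and vmin: "\<And>x. x \<in> V \<Longrightarrow> v \<le> x"
    using ne Suc.prems(1) by (auto simp: v_def)
  \<comment> \<open>The ballot inequality at \<open>v\<close> supplies an opening point up to
    \<open>v\<close>, and disjointness makes it strictly smaller.\<close>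
  have "0 < card (V \<inter> {..v})"
    using vV Suc.prems(1) by (auto simp: card_gt_0_iff)
  also have "\<dots> \<le> card (U \<inter> {..v})"
    by (rule Suc.prems(5))
  finally have "U \<inter> {..v} \<noteq> {}"
    by (simp add: card_gt_0_iff)
  moreover have "v \<notin> U"
    using vV Suc.prems(3) by blast
  ultimately have "U \<inter> {..<v} \<noteq> {}"
    by (metis Int_iff atMost_iff disjoint_iff lessThan_iff order_le_less)
  then have "u \<in> U \<inter> {..<v}"
    unfolding u_def using Suc.prems(2) by (intro Max_in) auto
  then have uU: "u \<in> U" "u < v" by auto
  have umax: "x \<le> u" if "x \<in> U" "x < v" for x
    unfolding u_def using that Suc.prems(2) by (intro Max_ge) auto
  \<comment> \<open>Below \<open>v\<close> there is no closing point; from \<open>v\<close> on both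
    counts drop by exactly one.\<close>
  have "card ((V - {v}) \<inter> {..t}) \<le> card ((U - {u}) \<inter> {..t})" for t
  proof (cases "t < v")
    case True
    then have "(V - {v}) \<inter> {..t} = {}"
      using vmin by fastforce
    then show ?thesis by simp
  next
    case False
    have "(V - {v}) \<inter> {..t} = V \<inter> {..t} - {v}" "(U - {u}) \<inter> {..t} = U \<inter> {..t} - {u}"
      by auto
    then show ?thesis
      using False uU vV Suc.prems(1,2) Suc.prems(5)[of t] by simp
  qed
  moreover have "n = card (V - {v})" "card (U - {u}) = card (V - {v})"
    using Suc.hyps(2) Suc.prems(1,2,4) uU vV by auto
  ultimately obtain M where M: "noncrossing_matching (U - {u}) (V - {v}) M"
    using Suc.hyps(1)[of "V - {v}" "U - {u}"] Suc.prems by auto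
  have mem: "a \<in> U" "a \<noteq> u" "v < b" if "(a, b) \<in> M" for a b
    using matching_mem[OF M that] vmin[of b] by auto
  have "noncrossing_matching U V (insert (u, v) M)"
  proof (rule noncrossing_matchingI)
    show "bij_betw fst (insert (u, v) M) U" "bij_betw snd (insert (u, v) M) V"
      using matching_fst[OF M] matching_snd[OF M] matching_inj_fst[OF M] matching_inj_snd[OF M]
        uU vV by (auto simp: bij_betw_def)
  next
    fix a b assume "(a, b) \<in> insert (u, v) M"
    then show "a < b"
      using uU matching_less[OF M] by auto
  next
    fix a b a' b'
    assume *: "(a, b) \<in> insert (u, v) M" "(a', b') \<in> insert (u, v) M" "a < a'" "a' < b" "b < b'"
    \<comment> \<open>The new pair cannot be the left one of a crossing, as an opening point between
      \<open>u\<close> and \<open>v\<close> would contradict the choice of \<open>u\<close>; nor the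
      right one, as all other closing points lie above \<open>v\<close>.\<close>
    consider "(a, b) \<in> M" "(a', b') \<in> M" | "(a, b) = (u, v)" "(a', b') \<in> M"
      | "(a, b) \<in> M" "(a', b') = (u, v)"
      using * by auto
    then show False
    proof cases
      case 1
      then show ?thesis using matching_noncrossing[OF M] * by blast
    next
      case 2
      then show ?thesis using * umax mem by fastforce
    next
      case 3
      then show ?thesis using * mem by fastforce
    qed
  qed
  then show ?case by blast
qed

section \<open>Hook paths\<close>

text \<open>Both segments are parallel to an axis, so membership reduces to coordinate
  inequalities.\<close>

lemma mem_hook_path:
  assumes "i < j" "\<pi> i < \<pi> j"
  shows "(x, y) \<in> hook_path \<pi> (i, j) \<longleftrightarrow>
    x = real i \<and> real (\<pi> i) \<le> y \<and> y \<le> real (\<pi> j) \<or> real i \<le> x \<and> x \<le> real j \<and> y = real (\<pi> j)"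
proof -
  have "closed_segment (real_point (i, \<pi> i)) (real_point (i, \<pi> j)) = {real i} \<times> {real (\<pi> i)..real (\<pi> j)}"
    using assms by (simp add: real_point_def closed_segment_same_fst closed_segment_eq_real_ivl)
  moreover have "closed_segment (real_point (i, \<pi> j)) (real_point (j, \<pi> j)) = {real i..real j} \<times> {real (\<pi> j)}"
    using assms by (simp add: real_point_def closed_segment_same_snd closed_segment_eq_real_ivl)
  ultimately show ?thesis
    by (auto simp: hook_path_def)
qed

section \<open>Words and their level sets\<close>

lemma count_list_map_upt:
  "count_list (map g [1..<Suc t]) c = card {v \<in> {1..t}. g v = c}"
proof (induction t)
  case (Suc t)
  have "{v \<in> {1..Suc t}. g v = c} =
      (if g (Suc t) = c then insert (Suc t) {v \<in> {1..t}. g v = c} else {v \<in> {1..t}. g v = c})"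
    by (auto simp: le_Suc_eq)
  moreover have "map g [1..<Suc (Suc t)] = map g [1..<Suc t] @ [g (Suc t)]"
    by simp
  ultimately show ?case
    using Suc.IH by (simp del: upt_Suc)
qed simp

text \<open>The prefix of length \<open>t\<close> carries the letters at heights up to
  \<open>t\<close>, so the prefix conditions become ballot conditions on level sets, the form that
  matchings deal with.\<close>

lemma map_upt_in_Dyck3_iff:
  fixes g :: "nat \<Rightarrow> letter" and k :: nat
  defines "L \<equiv> \<lambda>c. {v \<in> {1..3 * k}. g v = c}"
  shows "map g [1..<Suc (3 * k)] \<in> Dyck3 k \<longleftrightarrow>
    (\<forall>c. card (L c) = k) \<and>
    (\<forall>t. card (L Y \<inter> {..t}) \<le> card (L X \<inter> {..t}) \<and> card (L Z \<inter> {..t}) \<le> card (L Y \<inter> {..t}))"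
proof -
  let ?w = "map g [1..<Suc (3 * k)]"
  have count: "count_list (take t ?w) c = card (L c \<inter> {..t})" for t c
  proof -
    have "take t ?w = map g [1..<Suc (min t (3 * k))]"
      by (simp add: take_map min_def del: upt_Suc)
    moreover have "L c \<inter> {..t} = {v \<in> {1..min t (3 * k)}. g v = c}"
      by (auto simp: L_def)
    ultimately show ?thesis
      by (simp only: count_list_map_upt)
  qed
  have "(\<forall>u. prefix u ?w \<longrightarrow> P u) \<longleftrightarrow> (\<forall>t. P (take t ?w))" for P :: "letter list \<Rightarrow> bool"
    by (metis take_is_prefix prefix_def append_eq_conv_conj)
  moreover have "(\<forall>c. card (L c) = k) \<longleftrightarrow> card (L X) = k \<and> card (L Y) = k \<and> card (L Z) = k"
    by (metis letter.exhaust)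
  moreover have "length ?w = 3 * k"
    by simp
  moreover have "count_list ?w c = card (L c)" for c
    unfolding L_def by (rule count_list_map_upt)
  ultimately show ?thesis
    by (simp only: Dyck3_def mem_Collect_eq count simp_thms conj_assoc)
qed

text \<open>Points are read by increasing height: \<open>X\<close> is a descent bottom, \<open>Y\<close> a descent top,
  \<open>Z\<close> a northeast endpoint.\<close>

definition point_letter :: "nat \<Rightarrow> (nat \<Rightarrow> nat) \<Rightarrow> nat \<Rightarrow> letter" where
  "point_letter n \<pi> v =
     (if v \<in> \<pi> ` Suc ` descents n \<pi> then X else if v \<in> \<pi> ` descents n \<pi> then Y else Z)"

definition height_word :: "nat \<Rightarrow> (nat \<Rightarrow> nat) \<Rightarrow> letter list" where
  "height_word n \<pi> = map (point_letter n \<pi>) [1..<Suc n]"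

section \<open>The letters of a configuration\<close>

locale red_vhc =
  fixes k :: nat and \<pi> :: "nat \<Rightarrow> nat" and H :: "(nat \<times> nat) set"
  assumes red: "(\<pi>, H) \<in> RedVHC (3 * k) k (Av312 (3 * k))" and k: "k \<ge> 1"
begin

text \<open>\<open>D\<close> and \<open>J\<close> consist of positions: those of the descent tops
  and of the northeast endpoints. The descent bottoms sit at the successors of
  \<open>D\<close>.\<close>

definition "D = descents (3 * k) \<pi>"
definition "J = snd ` H"

lemma perm: "\<pi> permutes {1..3 * k}"
  using red by (simp add: RedVHC_def Av312_def perms_def)

lemma avoids:
  assumes "a < b" "b < c" "\<pi> b < \<pi> c" "\<pi> c < \<pi> a" "1 \<le> a" "c \<le> 3 * k"
  shows False
proof -
  have "avoids_312 (3 * k) \<pi>"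
    using red by (simp add: RedVHC_def Av312_def)
  moreover have "a \<in> {1..3 * k}" "b \<in> {1..3 * k}" "c \<in> {1..3 * k}"
    using assms by auto
  ultimately show False
    using assms(1-4) unfolding avoids_312_def by blast
qed

lemma valid: "valid_hook_configuration (3 * k) \<pi> H"
  using red by (simp add: RedVHC_def)

lemma hooks: "(i, j) \<in> H \<Longrightarrow> i \<in> {1..3 * k} \<and> j \<in> {1..3 * k} \<and> i < j \<and> \<pi> i < \<pi> j"
  using valid by (auto simp: valid_hook_configuration_def hooks_on_def)

lemma hook_paths_disjoint:
  "h \<in> H \<Longrightarrow> h' \<in> H \<Longrightarrow> h \<noteq> h' \<Longrightarrow> x \<in> hook_path \<pi> h \<Longrightarrow> x \<in> hook_path \<pi> h' \<Longrightarrow>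
    x \<in> real_point ` {SW \<pi> h, NE \<pi> h}"
  using valid unfolding valid_hook_configuration_def by blast

lemma inj: "inj \<pi>"
  using perm by (rule permutes_inj)

lemma card_H: "card H = k"
  using red by (simp add: RedVHC_def)

text \<open>Infinite sets have \<open>card\<close> equal to 0, which \<open>k \<ge> 1\<close>
  excludes.\<close>

lemma finite_H: "finite H"
  using card_H k by (metis card.infinite not_one_le_zero)

lemma mem_D: "i \<in> D \<longleftrightarrow> 1 \<le> i \<and> i < 3 * k \<and> \<pi> (Suc i) < \<pi> i"
  by (simp add: D_def descents_def)

lemma fst_H: "fst ` H = D"
proof -
  have "SW \<pi> ` H = descent_tops (3 * k) \<pi>"
    using valid by (simp add: valid_hook_configuration_def)
  then have "fst ` SW \<pi> ` H = fst ` descent_tops (3 * k) \<pi>"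
    by simp
  moreover have "fst ` SW \<pi> ` H = fst ` H"
    by (simp add: image_image SW_def)
  moreover have "fst ` descent_tops (3 * k) \<pi> = D"
    by (force simp: descent_tops_def D_def)
  ultimately show ?thesis by simp
qed

lemma positions: "{1..3 * k} = D \<union> J \<union> Suc ` D"
proof
  show "D \<union> J \<union> Suc ` D \<subseteq> {1..3 * k}"
    using hooks by (auto simp: mem_D J_def)
  have "plot (3 * k) \<pi> \<subseteq> SW \<pi> ` H \<union> NE \<pi> ` H \<union> descent_bottoms (3 * k) \<pi>"
    using red by (simp add: RedVHC_def reduced_def)
  then have "fst ` plot (3 * k) \<pi> \<subseteq> fst ` SW \<pi> ` H \<union> fst ` NE \<pi> ` H \<union> fst ` descent_bottoms (3 * k) \<pi>"
    by blast
  moreover have "fst ` plot (3 * k) \<pi> = {1..3 * k}"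
    by (force simp: plot_def)
  moreover have "fst ` SW \<pi> ` H = D" "fst ` NE \<pi> ` H = J"
    by (simp_all add: image_image SW_def NE_def fst_H J_def)
  moreover have "fst ` descent_bottoms (3 * k) \<pi> = Suc ` D"
    by (force simp: descent_bottoms_def D_def)
  ultimately show "{1..3 * k} \<subseteq> D \<union> J \<union> Suc ` D"
    by simp
qed

lemma finite_D: "finite D" and finite_J: "finite J"
  using finite_H by (auto simp: fst_H[symmetric] J_def)

text \<open>The three kinds of points number at most \<open>k\<close> each but fill \<open>3 * k\<close> positions,
  so they do not overlap.\<close>

lemma card_disjoint:
  "card D = k" "card J = k" "card (Suc ` D) = k"
  "D \<inter> J = {}" "D \<inter> Suc ` D = {}" "J \<inter> Suc ` D = {}"
proof -
  have le: "card D \<le> k" "card J \<le> k" "card (Suc ` D) \<le> k"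
    using card_image_le[OF finite_H, of fst] card_image_le[OF finite_H, of snd]
      card_image_le[OF finite_D, of Suc] by (auto simp: fst_H J_def card_H)
  have "3 * k = card (D \<union> J \<union> Suc ` D)"
    using positions by (metis card_atLeastAtMost diff_Suc_1)
  moreover have "card (D \<union> J \<union> Suc ` D) + card ((D \<union> J) \<inter> Suc ` D) = card (D \<union> J) + card (Suc ` D)"
    "card (D \<union> J) + card (D \<inter> J) = card D + card J"
    using card_Un_Int finite_D finite_J by (metis finite_UnI finite_imageI)+
  ultimately have *: "card D = k" "card J = k" "card (Suc ` D) = k"
      "card ((D \<union> J) \<inter> Suc ` D) = 0" "card (D \<inter> J) = 0"
    using le by linarith+
  then show "card D = k" "card J = k" "card (Suc ` D) = k"
    by blast+
  show "D \<inter> J = {}" "D \<inter> Suc ` D = {}" "J \<inter> Suc ` D = {}"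
    using *(4,5) finite_D finite_J by auto
qed

text \<open>In an inversion between such positions the lower point is not a descent bottom, so its
  predecessor is smaller still and completes a 312 pattern.\<close>

lemma increasing:
  assumes "i \<in> D \<union> J" "j \<in> D \<union> J" "i < j"
  shows "\<pi> i < \<pi> j"
proof (rule ccontr)
  assume "\<not> \<pi> i < \<pi> j"
  then have gt: "\<pi> j < \<pi> i"
    using inj_eq[OF inj, of i j] assms(3) by linarith
  obtain j' where j': "j = Suc j'"
    using assms(3) by (cases j) auto
  have "j \<notin> Suc ` D" "1 \<le> i" "j \<le> 3 * k"
    using assms card_disjoint positions by auto
  then have "\<pi> j' < \<pi> j"
    using j' assms(3) inj_eq[OF inj, of j' j] by (simp add: image_iff mem_D)
  then show False
    using avoids[of i j' j] gt j' assms(3) \<open>1 \<le> i\<close> \<open>j \<le> 3 * k\<close> by (cases "i = j'") auto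
qed

lemma increasing_iff:
  assumes "i \<in> D \<union> J" "j \<in> D \<union> J"
  shows "\<pi> i < \<pi> j \<longleftrightarrow> i < j"
  using increasing assms by (metis linorder_neqE_nat order_less_asym order_less_irrefl)

text \<open>If two descent pairs crossed in height, the first descent together with the later
  descent bottom would form a 312 pattern.\<close>

lemma descent_matching:
  "noncrossing_matching (\<pi> ` Suc ` D) (\<pi> ` D) ((\<lambda>i. (\<pi> (Suc i), \<pi> i)) ` D)"
proof (rule noncrossing_matchingI)
  show "bij_betw fst ((\<lambda>i. (\<pi> (Suc i), \<pi> i)) ` D) (\<pi> ` Suc ` D)"
    "bij_betw snd ((\<lambda>i. (\<pi> (Suc i), \<pi> i)) ` D) (\<pi> ` D)"
    using inj by (force simp: bij_betw_def inj_on_def)+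
next
  fix u v assume "(u, v) \<in> (\<lambda>i. (\<pi> (Suc i), \<pi> i)) ` D"
  then show "u < v" by (auto simp: mem_D)
next
  fix u v u' v'
  assume *: "(u, v) \<in> (\<lambda>i. (\<pi> (Suc i), \<pi> i)) ` D" "(u', v') \<in> (\<lambda>i. (\<pi> (Suc i), \<pi> i)) ` D"
    "u < u'" "u' < v" "v < v'"
  then obtain i j where ij: "i \<in> D" "j \<in> D" "u = \<pi> (Suc i)" "v = \<pi> i" "u' = \<pi> (Suc j)" "v' = \<pi> j"
    by auto
  \<comment> \<open>The tops increase from left to right, so the lower top comes first.\<close>
  then have "i < j"
    using increasing_iff[of i j] * by auto
  then show False
    using avoids[of i "Suc i" "Suc j"] * ij by (auto simp: mem_D)
qed

text \<open>Heights and positions of tops and northeast endpoints are ordered alike, so a crossing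
  in height is one in position, and then the two paths cut each other.\<close>

lemma hook_matching: "noncrossing_matching (\<pi> ` D) (\<pi> ` J) (map_prod \<pi> \<pi> ` H)"
proof (rule noncrossing_matchingI)
  \<comment> \<open>Both projections map the \<open>k\<close> hooks onto \<open>k\<close>
    positions.\<close>
  have "inj_on fst H" "inj_on snd H"
    using card_disjoint fst_H J_def card_H finite_H by (auto intro!: eq_card_imp_inj_on)
  then show "bij_betw fst (map_prod \<pi> \<pi> ` H) (\<pi> ` D)" "bij_betw snd (map_prod \<pi> \<pi> ` H) (\<pi> ` J)"
    using inj by (force simp: bij_betw_def inj_on_def fst_H[symmetric] J_def)+
next
  fix u v assume "(u, v) \<in> map_prod \<pi> \<pi> ` H"
  then show "u < v" using hooks by auto
next
  fix u v u' v'
  assume *: "(u, v) \<in> map_prod \<pi> \<pi> ` H" "(u', v') \<in> map_prod \<pi> \<pi> ` H" "u < u'" "u' < v" "v < v'"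
  then obtain i j i' j' where ij: "(i, j) \<in> H" "(i', j') \<in> H" "u = \<pi> i" "v = \<pi> j" "u' = \<pi> i'" "v' = \<pi> j'"
    by auto
  then have mem: "i \<in> D \<union> J" "j \<in> D \<union> J" "i' \<in> D \<union> J" "j' \<in> D \<union> J"
    by (auto simp: J_def intro: rev_image_eqI simp flip: fst_H)
  then have lt: "i < i'" "i' < j" "j < j'"
    using * ij by (auto simp: increasing_iff)
  \<comment> \<open>Here the vertical segment of the second hook meets the horizontal segment of the
    first; the abscissa lies strictly between \<open>i\<close> and \<open>j\<close>, so this is no
    endpoint of the first hook.\<close>
  let ?x = "(real i', real (\<pi> j))"
  have "?x \<in> hook_path \<pi> (i, j)" "?x \<in> hook_path \<pi> (i', j')"
    using lt * hooks[OF ij(1)] hooks[OF ij(2)] ij by (simp_all add: mem_hook_path)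
  then have "?x \<in> real_point ` {SW \<pi> (i, j), NE \<pi> (i, j)}"
    using hook_paths_disjoint[OF ij(1,2)] lt by blast
  then show False
    using lt by (auto simp: SW_def NE_def real_point_def)
qed

text \<open>The kinds are disjoint and exhaust all heights, so the default letter \<open>Z\<close>
  marks exactly the northeast endpoints.\<close>

lemma level_sets:
  "{v \<in> {1..3 * k}. point_letter (3 * k) \<pi> v = X} = \<pi> ` Suc ` D"
  "{v \<in> {1..3 * k}. point_letter (3 * k) \<pi> v = Y} = \<pi> ` D"
  "{v \<in> {1..3 * k}. point_letter (3 * k) \<pi> v = Z} = \<pi> ` J"
proof -
  have all: "{1..3 * k} = \<pi> ` D \<union> \<pi> ` J \<union> \<pi> ` Suc ` D"
    using permutes_image[OF perm] positions by (simp add: image_Un)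
  have disj: "\<pi> ` D \<inter> \<pi> ` J = {}" "\<pi> ` D \<inter> \<pi> ` Suc ` D = {}" "\<pi> ` J \<inter> \<pi> ` Suc ` D = {}"
    using card_disjoint(4-6) by (simp_all only: image_Int[OF inj, symmetric] image_empty)
  have split:
    "{v \<in> B \<union> C \<union> A. (if v \<in> A then X else if v \<in> B then Y else Z) = X} = A"
    "{v \<in> B \<union> C \<union> A. (if v \<in> A then X else if v \<in> B then Y else Z) = Y} = B"
    "{v \<in> B \<union> C \<union> A. (if v \<in> A then X else if v \<in> B then Y else Z) = Z} = C"
    if "B \<inter> C = {}" "B \<inter> A = {}" "C \<inter> A = {}" for A B C :: "nat set"
    using that by auto
  have eq: "point_letter (3 * k) \<pi> v = (if v \<in> \<pi> ` Suc ` D then X else if v \<in> \<pi> ` D then Y else Z)" for v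
    by (simp add: point_letter_def D_def)
  show "{v \<in> {1..3 * k}. point_letter (3 * k) \<pi> v = X} = \<pi> ` Suc ` D"
    "{v \<in> {1..3 * k}. point_letter (3 * k) \<pi> v = Y} = \<pi> ` D"
    "{v \<in> {1..3 * k}. point_letter (3 * k) \<pi> v = Z} = \<pi> ` J"
    unfolding eq all using split[OF disj] by blast+
qed

text \<open>The descent matching gives the inequality between \<open>X\<close> and \<open>Y\<close>,
  the hook matching that between \<open>Y\<close> and \<open>Z\<close>.\<close>

lemma height_word_in_Dyck3: "height_word (3 * k) \<pi> \<in> Dyck3 k"
proof -
  have "card (\<pi> ` A) = card A" for A
    by (rule card_image) (rule inj_on_subset[OF inj subset_UNIV])
  then have "card {v \<in> {1..3 * k}. point_letter (3 * k) \<pi> v = c} = k" for c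
    by (cases c) (simp_all only: level_sets card_disjoint)
  moreover have "finite (\<pi> ` Suc ` D)" "finite (\<pi> ` D)"
    using finite_D by auto
  ultimately show ?thesis
    unfolding height_word_def map_upt_in_Dyck3_iff level_sets
    using matching_ballot[OF descent_matching] matching_ballot[OF hook_matching] by blast
qed

end

section \<open>Recovering a configuration from its word\<close>

text \<open>The value \<open>\<pi> i\<close> is taken by \<open>\<pi>'\<close> at some
  \<open>j\<close>. Agreement to the left and injectivity exclude \<open>j < i\<close>, and
  \<open>\<pi>'\<close> increases on tops and northeast endpoints. Used in both directions, this
  makes the next such value unique.\<close>

lemma red_vhc_value_le:
  assumes "red_vhc k \<pi> H" "red_vhc k \<pi>' H'"
    and levels: "\<pi> ` (red_vhc.D k \<pi> \<union> red_vhc.J H) = \<pi>' ` (red_vhc.D k \<pi>' \<union> red_vhc.J H')"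
    and less: "\<And>j. j < i \<Longrightarrow> \<pi> j = \<pi>' j"
    and i: "i \<in> red_vhc.D k \<pi> \<union> red_vhc.J H" "i \<in> red_vhc.D k \<pi>' \<union> red_vhc.J H'"
  shows "\<pi>' i \<le> \<pi> i"
proof -
  interpret p: red_vhc k \<pi> H by fact
  interpret q: red_vhc k \<pi>' H' by fact
  obtain j where j: "j \<in> q.D \<union> q.J" "\<pi> i = \<pi>' j"
    using levels i(1) by blast
  have "\<not> j < i"
    using less[of j] j(2) inj_eq[OF p.inj, of i j] by auto
  then show ?thesis
    using q.increasing_iff[OF j(1) i(2)] j(2) by simp
qed

text \<open>The word fixes the heights of each kind, hence the descent matching. The permutation is
  then rebuilt from left to right, and uniqueness of the hook matching recovers the hooks.\<close>

lemma height_word_inj: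
  assumes "red_vhc k \<pi> H" "red_vhc k \<pi>' H'" "height_word (3 * k) \<pi> = height_word (3 * k) \<pi>'"
  shows "\<pi> = \<pi>' \<and> H = H'"
proof -
  interpret p: red_vhc k \<pi> H by fact
  interpret q: red_vhc k \<pi>' H' by fact
  have "\<forall>v\<in>{1..3 * k}. point_letter (3 * k) \<pi> v = point_letter (3 * k) \<pi>' v"
    using assms(3) by (auto simp: height_word_def simp del: upt_Suc)
  then have "{v \<in> {1..3 * k}. point_letter (3 * k) \<pi> v = c} =
      {v \<in> {1..3 * k}. point_letter (3 * k) \<pi>' v = c}" for c
    by auto
  then have X: "\<pi> ` Suc ` p.D = \<pi>' ` Suc ` q.D" and Y: "\<pi> ` p.D = \<pi>' ` q.D"
    and Z: "\<pi> ` p.J = \<pi>' ` q.J"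
    using p.level_sets q.level_sets by metis+
  have YZ: "\<pi> ` (p.D \<union> p.J) = \<pi>' ` (q.D \<union> q.J)"
    by (simp add: image_Un Y Z)
  have pairs: "(\<lambda>i. (\<pi> (Suc i), \<pi> i)) ` p.D = (\<lambda>i. (\<pi>' (Suc i), \<pi>' i)) ` q.D"
  proof (rule noncrossing_matching_unique)
    show "finite (\<pi>' ` q.D)" "finite (\<pi>' ` Suc ` q.D)"
      using q.finite_D by auto
  qed (use p.descent_matching q.descent_matching X Y in simp_all)
  have bottoms: "d \<in> q.D \<and> \<pi> (Suc d) = \<pi>' (Suc d)" if "d \<in> p.D" "\<pi> d = \<pi>' d" for d
  proof -
    have "(\<pi> (Suc d), \<pi> d) \<in> (\<lambda>i. (\<pi>' (Suc i), \<pi>' i)) ` q.D"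
      using that pairs by blast
    then show ?thesis
      using that inj_eq[OF q.inj] by auto
  qed
  have bottoms': "d \<in> p.D" if "d \<in> q.D" "\<pi> d = \<pi>' d" for d
  proof -
    have "\<pi>' d \<in> \<pi> ` p.D"
      using that(1) Y by blast
    then show ?thesis
      unfolding that(2)[symmetric] by (simp only: inj_image_mem_iff[OF p.inj])
  qed
  have "\<pi> i = \<pi>' i" for i
  proof (induction i rule: less_induct)
    case (less i)
    show ?case
    proof (cases "i \<in> Suc ` p.D")
      case True
      then obtain d where d: "i = Suc d" "d \<in> p.D"
        by (elim imageE)
      have "\<pi> d = \<pi>' d"
        by (rule less) (simp only: d(1) lessI)
      then show ?thesis
        unfolding d(1) by (rule conjunct2[OF bottoms[OF d(2)]])
    next
      case False
      \<comment> \<open>Being a bottom is decided at the position before, where the two permutations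
        already agree.\<close>
      have notin: "i \<notin> Suc ` q.D"
      proof
        assume "i \<in> Suc ` q.D"
        then obtain d where d: "i = Suc d" "d \<in> q.D"
          by (elim imageE)
        have "\<pi> d = \<pi>' d"
          by (rule less) (simp only: d(1) lessI)
        then have "d \<in> p.D"
          by (rule bottoms'[OF d(2)])
        then show False
          using False d(1) by blast
      qed
      show ?thesis
      proof (cases "i \<in> {1..3 * k}")
        case True
        then have "i \<in> p.D \<union> p.J" "i \<in> q.D \<union> q.J"
          using False notin p.positions q.positions by blast+
        then show ?thesis
          using red_vhc_value_le[OF assms(1,2) YZ, of i]
            red_vhc_value_le[OF assms(2,1) YZ[symmetric], of i] less
          by (metis order_antisym)
      next
        case False
        then show ?thesis
          using permutes_not_in[OF p.perm] permutes_not_in[OF q.perm] by simp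
      qed
    qed
  qed
  then have eq: "\<pi> = \<pi>'" by (rule ext)
  \<comment> \<open>The hooks are compared through their heights; injectivity of
    \<open>\<pi>\<close> brings the result back to positions.\<close>
  have "map_prod \<pi> \<pi> ` H = map_prod \<pi> \<pi> ` H'"
  proof (rule noncrossing_matching_unique)
    show "finite (\<pi>' ` q.J)" "finite (\<pi>' ` q.D)"
      using q.finite_D q.finite_J by auto
    show "noncrossing_matching (\<pi>' ` q.D) (\<pi>' ` q.J) (map_prod \<pi> \<pi> ` H)"
      using p.hook_matching by (simp only: Y Z)
    show "noncrossing_matching (\<pi>' ` q.D) (\<pi>' ` q.J) (map_prod \<pi> \<pi> ` H')"
      using q.hook_matching by (simp only: eq)
  qed
  then have "H = H'"
    using prod.inj_map[OF p.inj p.inj] by (simp add: inj_image_eq_iff)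
  then show ?thesis
    using eq by simp
qed

section \<open>The configuration of a word\<close>

text \<open>\<open>U\<close>, \<open>V\<close>, \<open>W\<close> stand for the places of
  \<open>X\<close>, \<open>Y\<close>, \<open>Z\<close> in a word, read as heights. \<open>M1\<close>
  will pair each descent bottom with its top, and \<open>M2\<close> will give the hooks.\<close>

locale letter_positions =
  fixes k :: nat and U V W :: "nat set" and M1 M2 :: "(nat \<times> nat) set"
  assumes positions: "{1..3 * k} = U \<union> V \<union> W"
    and disjoint: "U \<inter> V = {}" "U \<inter> W = {}" "V \<inter> W = {}"
    and cards: "card V = k" "card W = k"
    and descent_matching: "noncrossing_matching U V M1"
    and hook_matching: "noncrossing_matching V W M2"
begin

text \<open>A bottom is represented by the top it belongs to, any other point by itself.\<close>

definition top_of :: "nat \<Rightarrow> nat" where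
  "top_of x = (if x \<in> U then THE v. (x, v) \<in> M1 else x)"

text \<open>From left to right, every \<open>Y\<close> contributes two adjacent points and every \<open>Z\<close> one.\<close>

definition block :: "nat \<Rightarrow> nat" where
  "block t = 1 + 2 * card (V \<inter> {..<t}) + card (W \<inter> {..<t})"

text \<open>This maps heights to columns, so it is the inverse of the permutation sought. A bottom
  goes one step to the right of its top.\<close>

definition position :: "nat \<Rightarrow> nat" where
  "position x = (if x \<in> {1..3 * k} then block (top_of x) + (if x \<in> U then 1 else 0) else x)"

lemma finite_V: "finite V" and finite_W: "finite W"
  using finite_subset[of _ "{1..3 * k}"] positions by blast+

lemma top_of_U:
  assumes "(u, v) \<in> M1"
  shows "top_of u = v"
proof -
  have "u \<in> U"
    using matching_mem[OF descent_matching] assms by blast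
  moreover have "(THE v. (u, v) \<in> M1) = v"
    using assms matching_unique_snd[OF descent_matching] by blast
  ultimately show ?thesis by (simp add: top_of_def)
qed

lemma top_of_pair: "x \<in> U \<Longrightarrow> (x, top_of x) \<in> M1"
  using top_of_U matching_ex_snd[OF descent_matching] by metis

lemma top_of_U_mem: "x \<in> U \<Longrightarrow> top_of x \<in> V \<and> x < top_of x"
  using top_of_pair matching_mem[OF descent_matching] matching_less[OF descent_matching] by blast

lemma top_of_not_U: "x \<notin> U \<Longrightarrow> top_of x = x"
  by (simp add: top_of_def)

lemma top_of_ge: "x \<le> top_of x"
  using top_of_U_mem[of x] top_of_not_U[of x] by (cases "x \<in> U") auto

lemma top_of_mem: "x \<in> {1..3 * k} \<Longrightarrow> top_of x \<in> V \<union> W"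
  using top_of_U_mem top_of_not_U positions by fastforce

lemma top_of_VW: "x \<in> V \<union> W \<Longrightarrow> top_of x = x"
  using disjoint by (intro top_of_not_U) blast

text \<open>Passing a \<open>Y\<close> leaves room for a top and its bottom, passing a
  \<open>Z\<close> for a single point.\<close>

lemma block_less:
  assumes "s < t"
  shows "s \<in> V \<Longrightarrow> block s + 2 \<le> block t" "s \<in> W \<Longrightarrow> block s + 1 \<le> block t"
proof -
  have sub: "V \<inter> {..<s} \<subseteq> V \<inter> {..<t}" "W \<inter> {..<s} \<subseteq> W \<inter> {..<t}"
    using assms by auto
  then have le: "card (V \<inter> {..<s}) \<le> card (V \<inter> {..<t})" "card (W \<inter> {..<s}) \<le> card (W \<inter> {..<t})"
    using finite_V finite_W by (auto intro!: card_mono)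
  show "block s + 2 \<le> block t" if "s \<in> V"
  proof -
    have "V \<inter> {..<s} \<subset> V \<inter> {..<t}"
      using sub that assms by blast
    then have "card (V \<inter> {..<s}) < card (V \<inter> {..<t})"
      using finite_V by (intro psubset_card_mono) auto
    then show ?thesis using le by (simp add: block_def)
  qed
  show "block s + 1 \<le> block t" if "s \<in> W"
  proof -
    have "W \<inter> {..<s} \<subset> W \<inter> {..<t}"
      using sub that assms by blast
    then have "card (W \<inter> {..<s}) < card (W \<inter> {..<t})"
      using finite_W by (intro psubset_card_mono) auto
    then show ?thesis using le by (simp add: block_def)
  qed
qed

lemma position_less:
  assumes "x \<in> {1..3 * k}" "y \<in> {1..3 * k}" "top_of x < top_of y"
  shows "position x < position y"
proof (cases "x \<in> U")
  case True
  then show ?thesis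
    using block_less(1)[OF assms(3)] top_of_U_mem assms by (simp add: position_def)
next
  case False
  then show ?thesis
    using block_less[OF assms(3)] top_of_mem[OF assms(1)] assms by (auto simp: position_def)
qed

lemma position_less_iff:
  assumes "x \<in> {1..3 * k}" "y \<in> {1..3 * k}"
  shows "position x < position y \<longleftrightarrow>
    top_of x < top_of y \<or> top_of x = top_of y \<and> x \<notin> U \<and> y \<in> U"
proof (cases "top_of x = top_of y")
  case True
  then show ?thesis using assms by (simp add: position_def)
next
  case False
  then show ?thesis
    using position_less[of x y] position_less[of y x] assms by fastforce
qed

lemma position_VW_less_iff:
  assumes "x \<in> V \<union> W" "y \<in> V \<union> W"
  shows "position x < position y \<longleftrightarrow> x < y"
proof -
  have "x \<in> {1..3 * k}" "y \<in> {1..3 * k}" "y \<notin> U"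
    using assms positions disjoint by blast+
  then show ?thesis
    using position_less_iff[of x y] top_of_VW assms by simp
qed

text \<open>The column determines \<open>top_of x\<close> and membership in \<open>U\<close>, and
  the matching recovers \<open>x\<close> from these.\<close>

lemma inj_position: "inj_on position {1..3 * k}"
proof (rule inj_onI)
  fix x y assume xy: "x \<in> {1..3 * k}" "y \<in> {1..3 * k}" "position x = position y"
  then have "top_of x = top_of y" "x \<in> U \<longleftrightarrow> y \<in> U"
    using position_less_iff[of x y] position_less_iff[of y x] by (auto simp: neq_iff)
  then show "x = y"
    using top_of_pair[of x] top_of_pair[of y] top_of_not_U[of x] top_of_not_U[of y]
      matching_unique_fst[OF descent_matching] by metis
qed

text \<open>Each block ends before the next one can start, and \<open>block\<close> never exceeds
  \<open>3 * k + 1\<close>, since \<open>V\<close> and \<open>W\<close> have \<open>k\<close>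
  elements each.\<close>

lemma position_range:
  assumes "x \<in> {1..3 * k}"
  shows "position x \<in> {1..3 * k}"
proof -
  let ?t = "Suc (top_of x)"
  have "card (V \<inter> {..<?t}) \<le> k" "card (W \<inter> {..<?t}) \<le> k"
    using card_mono[OF finite_V, of "V \<inter> {..<?t}"] card_mono[OF finite_W, of "W \<inter> {..<?t}"] cards
    by auto
  then have "block ?t \<le> 3 * k + 1"
    by (simp add: block_def)
  moreover have "block (top_of x) + 2 \<le> block ?t" if "x \<in> U"
    using block_less(1)[of "top_of x" ?t] top_of_U_mem that by simp
  moreover have "block (top_of x) + 1 \<le> block ?t"
    using block_less[of "top_of x" ?t] top_of_mem[OF assms] by auto
  moreover have "1 \<le> block (top_of x)"
    by (simp add: block_def)
  ultimately show ?thesis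
    using assms by (auto simp: position_def)
qed

lemma position_permutes: "position permutes {1..3 * k}"
proof (rule bij_imp_permutes)
  have "position ` {1..3 * k} = {1..3 * k}"
    using inj_position position_range by (intro endo_inj_surj) auto
  then show "bij_betw position {1..3 * k} {1..3 * k}"
    using inj_position by (simp add: bij_betw_def)
qed (auto simp: position_def)

section \<open>The permutation and the hooks given by the columns\<close>

definition perm :: "nat \<Rightarrow> nat" where
  "perm = inv position"

definition hooks :: "(nat \<times> nat) set" where
  "hooks = map_prod position position ` M2"

lemma perm_permutes: "perm permutes {1..3 * k}"
  unfolding perm_def using position_permutes by (rule permutes_inv)

lemma perm_position [simp]: "perm (position x) = x"
  unfolding perm_def using position_permutes by (rule permutes_inverses)

lemma positionE:
  assumes "i \<in> {1..3 * k}"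
  obtains x where "x \<in> {1..3 * k}" "i = position x"
  using assms permutes_image[OF position_permutes] by blast

lemma position_U: "(u, v) \<in> M1 \<Longrightarrow> position u = Suc (position v)"
  using matching_mem[OF descent_matching, of u v] top_of_U[of u v] top_of_VW[of v] positions disjoint
  by (auto simp: position_def)

text \<open>Each bottom stands directly to the right of a higher top. Conversely,
  \<open>top_of\<close> never decreases along the columns, so a drop in height can only end at a
  bottom.\<close>

lemma descents_perm: "descents (3 * k) perm = position ` V"
proof
  show "position ` V \<subseteq> descents (3 * k) perm"
  proof
    fix i assume "i \<in> position ` V"
    then obtain u v where uv: "(u, v) \<in> M1" "i = position v"
      using matching_ex_fst[OF descent_matching] by blast
    then have "position u \<in> {1..3 * k}" "position v \<in> {1..3 * k}" "u < v"
      using matching_mem[OF descent_matching, of u v] matching_less[OF descent_matching, of u v]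
        positions position_range by blast+
    moreover have "perm (Suc (position v)) = u"
      using perm_position[of u] position_U[OF uv(1)] by simp
    ultimately show "i \<in> descents (3 * k) perm"
      using uv position_U[OF uv(1)] by (simp add: descents_def)
  qed
next
  show "descents (3 * k) perm \<subseteq> position ` V"
  proof
    fix i assume i: "i \<in> descents (3 * k) perm"
    then have "i \<in> {1..3 * k}" "Suc i \<in> {1..3 * k}"
      by (auto simp: descents_def)
    then obtain x y where xy: "x \<in> {1..3 * k}" "i = position x" "y \<in> {1..3 * k}" "Suc i = position y"
      by (metis positionE)
    have "perm (Suc i) < perm i"
      using i by (simp add: descents_def)
    then have "y < x"
      by (simp only: xy(4)) (simp only: xy(2) perm_position)
    moreover have "position x < position y"
      using xy(2,4) by linarith
    then have "top_of x \<le> top_of y"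
      using position_less_iff[OF xy(1,3)] by auto
    \<comment> \<open>Otherwise \<open>x \<le> top_of x \<le> top_of y = y\<close>, against
      \<open>y < x\<close>.\<close>
    ultimately have "y \<in> U"
      using top_of_ge[of x] top_of_not_U[of y] by force
    then have "Suc (position (top_of y)) = Suc i" "top_of y \<in> V"
      using position_U[OF top_of_pair] xy top_of_U_mem by auto
    then show "i \<in> position ` V"
      by auto
  qed
qed

lemma descents_perm_Suc: "Suc ` descents (3 * k) perm = position ` U"
proof -
  have "Suc ` position ` snd ` M1 = (\<lambda>m. Suc (position (snd m))) ` M1"
    by (simp only: image_image)
  also have "\<dots> = (\<lambda>m. position (fst m)) ` M1"
    using position_U by (intro image_cong) auto
  also have "\<dots> = position ` fst ` M1"
    by (simp only: image_image)
  finally show ?thesis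
    by (simp only: descents_perm matching_fst[OF descent_matching] matching_snd[OF descent_matching])
qed

lemma point_letter_perm:
  "point_letter (3 * k) perm v = (if v \<in> U then X else if v \<in> V then Y else Z)"
  by (simp add: point_letter_def descents_perm_Suc) (simp add: descents_perm image_image)

text \<open>The 1 and the 2 of a 312 pattern would be descent bottoms whose pairs cross.\<close>

lemma perm_avoids: "avoids_312 (3 * k) perm"
  unfolding avoids_312_def
proof (intro notI, elim bexE conjE)
  fix a b c
  assume mem: "a \<in> {1..3 * k}" "b \<in> {1..3 * k}" "c \<in> {1..3 * k}"
    and less: "a < b" "b < c" "perm b < perm c" "perm c < perm a"
  obtain x where x: "x \<in> {1..3 * k}" "a = position x" using mem(1) by (rule positionE)
  obtain y where y: "y \<in> {1..3 * k}" "b = position y" using mem(2) by (rule positionE)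
  obtain z where z: "z \<in> {1..3 * k}" "c = position z" using mem(3) by (rule positionE)
  have xyz: "y < z" "z < x"
    using less x y z by simp_all
  have xy: "top_of x \<le> top_of y"
    using position_less_iff[of x y] less x y by auto
  have yz: "top_of y < top_of z \<or> top_of y = top_of z \<and> y \<notin> U"
    using position_less_iff[of y z] less y z by auto
  have "x \<le> top_of x"
    by (rule top_of_ge)
  then have "y \<in> U" "z \<in> U"
    using xyz xy yz top_of_not_U[of y] top_of_not_U[of z] by force+
  then show False
    using matching_noncrossing[OF descent_matching top_of_pair top_of_pair, of y z]
      xyz xy yz \<open>x \<le> top_of x\<close> by simp
qed

lemma hook_mem: "(v, w) \<in> M2 \<Longrightarrow> v \<in> V \<and> w \<in> W \<and> v < w"
  using matching_mem[OF hook_matching] matching_less[OF hook_matching] by blast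

lemma hook_position_less: "(v, w) \<in> M2 \<Longrightarrow> position v < position w"
  using hook_mem position_VW_less_iff by blast

text \<open>Noncrossing leaves two cases: the first hook ends at a smaller height than the second
  one starts, or the second lies to the right of the vertical segment of the first and below its
  horizontal one.\<close>

lemma hook_paths_disjoint:
  assumes "(v, w) \<in> M2" "(v', w') \<in> M2" "v < v'"
  shows "hook_path perm (position v, position w) \<inter> hook_path perm (position v', position w') = {}"
proof -
  have mem: "v \<in> V" "w \<in> W" "v < w" "v' \<in> V" "w' \<in> W" "v' < w'"
    using hook_mem assms by auto
  have "w \<noteq> v'"
    using mem disjoint by auto
  moreover have "w \<noteq> w'"
    using matching_unique_fst[OF hook_matching, of v w v'] assms by auto
  ultimately have "w < v' \<or> w' < w"
    using matching_noncrossing[OF hook_matching assms(1,2)] assms(3) by (meson linorder_neqE_nat)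
  moreover have "position v < position v'"
    using position_VW_less_iff[of v v'] mem assms(3) by blast
  ultimately show ?thesis
    using hook_position_less[OF assms(1)] hook_position_less[OF assms(2)] mem
    by (auto simp: mem_hook_path)
qed

lemma fst_hooks: "fst ` hooks = position ` V" and snd_hooks: "snd ` hooks = position ` W"
proof -
  have "fst ` hooks = position ` fst ` M2" "snd ` hooks = position ` snd ` M2"
    by (simp_all add: hooks_def image_image)
  then show "fst ` hooks = position ` V" "snd ` hooks = position ` W"
    by (simp_all only: matching_fst[OF hook_matching] matching_snd[OF hook_matching])
qed

lemma card_hooks: "card hooks = k"
proof -
  have "inj position"
    using position_permutes by (rule permutes_inj)
  then have "inj (map_prod position position)"
    by (intro prod.inj_map)
  then have "card hooks = card M2"
    unfolding hooks_def by (rule card_image[OF inj_on_subset[OF _ subset_UNIV]])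
  also have "\<dots> = card (fst ` M2)"
    using matching_inj_fst[OF hook_matching] by (simp add: card_image)
  also have "\<dots> = k"
    by (simp add: matching_fst[OF hook_matching] cards)
  finally show ?thesis .
qed

lemma SW_image: "SW perm ` A = (\<lambda>i. (i, perm i)) ` fst ` A"
  and NE_image: "NE perm ` A = (\<lambda>i. (i, perm i)) ` snd ` A"
  by (simp_all add: SW_def NE_def image_image)

lemma valid: "valid_hook_configuration (3 * k) perm hooks"
  unfolding valid_hook_configuration_def
proof (intro conjI)
  show "hooks \<subseteq> hooks_on (3 * k) perm"
  proof
    fix h assume "h \<in> hooks"
    then obtain v w where vw: "(v, w) \<in> M2" "h = (position v, position w)"
      by (auto simp: hooks_def)
    then have "position v \<in> {1..3 * k}" "position w \<in> {1..3 * k}"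
      using hook_mem[OF vw(1)] positions position_range by blast+
    then show "h \<in> hooks_on (3 * k) perm"
      using vw hook_mem[OF vw(1)] hook_position_less[OF vw(1)] by (simp add: hooks_on_def)
  qed
  have "descent_tops (3 * k) perm = (\<lambda>i. (i, perm i)) ` descents (3 * k) perm"
    by (auto simp: descent_tops_def)
  then show "SW perm ` hooks = descent_tops (3 * k) perm"
    by (simp only: SW_image fst_hooks descents_perm)
  show "\<forall>(i, j)\<in>hooks. \<not> (\<exists>l. i < l \<and> l < j \<and> perm l > perm j)"
  proof (clarify)
    fix i j l assume ij: "(i, j) \<in> hooks" and l: "i < l" "l < j" "perm j < perm l"
    obtain v w where vw: "(v, w) \<in> M2" "i = position v" "j = position w"
      using ij by (auto simp: hooks_def)
    have w: "w \<in> W" "w \<in> {1..3 * k}"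
      using hook_mem[OF vw(1)] positions by blast+
    have "l \<in> {1..3 * k}"
      using l position_range[OF w(2)] vw by auto
    then obtain x where x: "x \<in> {1..3 * k}" "l = position x"
      by (rule positionE)
    \<comment> \<open>Columns to the left of that of \<open>w\<close> have \<open>top_of\<close> at
      most \<open>w\<close>, and no height exceeds its \<open>top_of\<close>.\<close>
    have "top_of x \<le> w"
      using position_less_iff[OF x(1) w(2)] l vw x top_of_VW[of w] w by auto
    then show False
      using top_of_ge[of x] l vw x by simp
  qed
  show "\<forall>h\<in>hooks. \<forall>h'\<in>hooks. h \<noteq> h' \<longrightarrow> hook_path perm h \<inter> hook_path perm h' \<subseteq>
      real_point ` ({SW perm h, NE perm h} \<inter> {SW perm h', NE perm h'})"
  proof (intro ballI impI)
    fix h h' assume "h \<in> hooks" "h' \<in> hooks" and ne: "h \<noteq> h'"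
    then obtain v w v' w' where
      vw: "(v, w) \<in> M2" "h = (position v, position w)" "(v', w') \<in> M2" "h' = (position v', position w')"
      by (auto simp: hooks_def)
    then have "v \<noteq> v'"
      using ne matching_unique_snd[OF hook_matching, of v w w'] by auto
    then have "hook_path perm h \<inter> hook_path perm h' = {}"
      using hook_paths_disjoint[OF vw(1,3)] hook_paths_disjoint[OF vw(3,1)] vw(2,4)
      by (metis Int_commute neq_iff)
    then show "hook_path perm h \<inter> hook_path perm h' \<subseteq>
        real_point ` ({SW perm h, NE perm h} \<inter> {SW perm h', NE perm h'})"
      by simp
  qed
qed

lemma reduced: "reduced (3 * k) perm hooks"
proof -
  have "plot (3 * k) perm = (\<lambda>i. (i, perm i)) ` {1..3 * k}"
    by (auto simp: plot_def)
  moreover have "{1..3 * k} = position ` U \<union> position ` V \<union> position ` W"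
    using permutes_image[OF position_permutes] positions by (simp add: image_Un)
  moreover have "descent_bottoms (3 * k) perm = (\<lambda>i. (i, perm i)) ` Suc ` descents (3 * k) perm"
    by (auto simp: descent_bottoms_def)
  ultimately show ?thesis
    by (auto simp: reduced_def SW_image NE_image fst_hooks snd_hooks descents_perm_Suc)
qed

lemma in_RedVHC: "(perm, hooks) \<in> RedVHC (3 * k) k (Av312 (3 * k))"
  using perm_permutes perm_avoids valid reduced card_hooks
  by (simp add: RedVHC_def Av312_def perms_def)

end

section \<open>Surjectivity and the bijection\<close>

text \<open>The ballot conditions of the word supply both matchings, and the configuration built
  from them reads back the word.\<close>

lemma height_word_surj:
  assumes "w \<in> Dyck3 k"
  shows "\<exists>(\<pi>, H) \<in> RedVHC (3 * k) k (Av312 (3 * k)). height_word (3 * k) \<pi> = w"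
proof -
  \<comment> \<open>Heights start at 1, list indices at 0.\<close>
  define g where "g v = w ! (v - 1)" for v
  define L where "L c = {v \<in> {1..3 * k}. g v = c}" for c
  have len: "length w = 3 * k"
    using assms by (simp add: Dyck3_def)
  have w: "w = map g [1..<Suc (3 * k)]"
    by (rule nth_equalityI) (auto simp: len g_def simp del: upt_Suc)
  have cards: "card (L c) = k"
    and ballot: "card (L Y \<inter> {..t}) \<le> card (L X \<inter> {..t})" "card (L Z \<inter> {..t}) \<le> card (L Y \<inter> {..t})" for c t
    using assms unfolding w map_upt_in_Dyck3_iff L_def by blast+
  have fin: "finite (L c)" for c
    by (simp add: L_def)
  have disj: "L X \<inter> L Y = {}" "L X \<inter> L Z = {}" "L Y \<inter> L Z = {}"
    by (auto simp: L_def)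
  obtain M1 where M1: "noncrossing_matching (L X) (L Y) M1"
    using noncrossing_matching_exists[of "L Y" "L X"] fin disj cards ballot by auto
  obtain M2 where M2: "noncrossing_matching (L Y) (L Z) M2"
    using noncrossing_matching_exists[of "L Z" "L Y"] fin disj cards ballot by auto
  have all: "{1..3 * k} = L X \<union> L Y \<union> L Z"
  proof -
    have "g v = X \<or> g v = Y \<or> g v = Z" for v
      by (cases "g v") auto
    then show ?thesis
      by (auto simp: L_def)
  qed
  interpret letter_positions k "L X" "L Y" "L Z" M1 M2
    by (intro letter_positions.intro all disj cards M1 M2)
  have "point_letter (3 * k) perm v = g v" if "v \<in> {1..3 * k}" for v
    unfolding point_letter_perm using that by (cases "g v") (auto simp: L_def)
  then have "height_word (3 * k) perm = w"
    unfolding w height_word_def by (intro map_cong) auto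
  then show ?thesis
    using in_RedVHC by blast
qed

theorem theorem3p2:
  fixes k :: nat
  assumes "k \<ge> 1"
  shows "\<exists>f. bij_betw f (RedVHC (3 * k) k (Av312 (3 * k))) (Dyck3 k)"
proof (intro exI[of _ "\<lambda>(\<pi>, H). height_word (3 * k) \<pi>"] bij_betw_imageI inj_onI)
  let ?R = "RedVHC (3 * k) k (Av312 (3 * k))"
  have red: "red_vhc k \<pi> H" if "(\<pi>, H) \<in> ?R" for \<pi> H
    using that assms by (simp add: red_vhc_def)
  fix c c' assume *: "c \<in> ?R" "c' \<in> ?R"
    "(\<lambda>(\<pi>, H). height_word (3 * k) \<pi>) c = (\<lambda>(\<pi>, H). height_word (3 * k) \<pi>) c'"
  obtain \<pi> H \<pi>' H' where c: "c = (\<pi>, H)" "c' = (\<pi>', H')"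
    by (metis surj_pair)
  then show "c = c'"
    using height_word_inj[of k \<pi> H \<pi>' H'] red * by simp
next
  let ?R = "RedVHC (3 * k) k (Av312 (3 * k))"
  have "height_word (3 * k) \<pi> \<in> Dyck3 k" if "(\<pi>, H) \<in> ?R" for \<pi> H
    using that assms by (intro red_vhc.height_word_in_Dyck3) (simp add: red_vhc_def)
  then show "(\<lambda>(\<pi>, H). height_word (3 * k) \<pi>) ` ?R = Dyck3 k"
    using height_word_surj[of _ k] by fastforce
qed

end
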